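(* For every finite hypergraph $H\Gamma=(V,E,r,s)$ with hypergraph $C^*$-algebra $C^*(H\Gamma)$ generated by $\{p_v\mid v\in V\}$ and $\{s_e\mid e\in E\}$, the element $\sum_{v\in V}p_v$ is the unit element of $C^*(H\Gamma)$; that is, $\sum_{v\in V}p_v=1$.
   Context: A (finite directed) hypergraph $H\Gamma=(V,E,r,s)$ consists of finite sets $V$ (vertices) and $E$ (edges) and maps $r,s:E\to\mathcal P(V)\setminus\{\emptyset\}$ (range and source), where $\mathcal P(V)$ is the power set. A vertex $v$ is a sink if $v\notin s(e)$ for all $e\in E$. The hypergraph $C^*$-algebra $C^*(H\Gamma)$ is the universal $C^*$-algebra generated by mutually orthogonal projections $p_v$ ($v\in V$) and partial isometries $s_e$ ($e\in E$) such that: (HR1) $s_e^*s_f=\delta_{ef}\sum_{v\in r(e)}p_v$ for all $e,f\in E$; (HR2a) $s_es_e^*\le\sum_{v\in s(e)}p_v$ for all $e\in E$; (HR2b) $p_v\le\sum_{e\in E,\,v\in s(e)}s_es_e^*$ for all $v\in V$ that are not sinks. (No unit is included in the generators or relations.) *)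

theory Defs
  imports Complex_Main "HOL-Algebra.Module"
begin

section \<open>C*-algebras\<close>

definition complex_ring :: "complex ring" where
  "complex_ring = \<lparr>carrier = UNIV, mult = (*), one = 1, zero = 0, add = (+)\<rparr>"

text \<open>C*-algebras are carrier-based, so that one can quantify over them inside a definition, and
  need not be unital: the field \<open>one\<close> inherited from the record of rings is left unconstrained
  and is never used. Being a unit is the predicate \<open>is_unit_element\<close> below.\<close>

record 'a cstar = "(complex, 'a) module" +
  star :: "'a \<Rightarrow> 'a"
  cnorm :: "'a \<Rightarrow> real"

definition seq_tendsto :: "('a, 'm) cstar_scheme \<Rightarrow> (nat \<Rightarrow> 'a) \<Rightarrow> 'a \<Rightarrow> bool" where
  "seq_tendsto A x l \<longleftrightarrow> (\<lambda>n. cnorm A (x n \<ominus>\<^bsub>A\<^esub> l)) \<longlonglongrightarrow> 0"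

definition cauchy_seq :: "('a, 'm) cstar_scheme \<Rightarrow> (nat \<Rightarrow> 'a) \<Rightarrow> bool" where
  "cauchy_seq A x \<longleftrightarrow> (\<forall>\<epsilon>>0. \<exists>N. \<forall>m\<ge>N. \<forall>n\<ge>N. cnorm A (x m \<ominus>\<^bsub>A\<^esub> x n) < \<epsilon>)"

locale cstar_algebra = module complex_ring A for A (structure) +
  assumes mult_closed: "\<lbrakk>x \<in> carrier A; y \<in> carrier A\<rbrakk> \<Longrightarrow> x \<otimes> y \<in> carrier A"
    and mult_assoc: "\<lbrakk>x \<in> carrier A; y \<in> carrier A; z \<in> carrier A\<rbrakk>
      \<Longrightarrow> (x \<otimes> y) \<otimes> z = x \<otimes> (y \<otimes> z)"
    and mult_add_left: "\<lbrakk>x \<in> carrier A; y \<in> carrier A; z \<in> carrier A\<rbrakk>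
      \<Longrightarrow> (x \<oplus> y) \<otimes> z = x \<otimes> z \<oplus> y \<otimes> z"
    and mult_add_right: "\<lbrakk>x \<in> carrier A; y \<in> carrier A; z \<in> carrier A\<rbrakk>
      \<Longrightarrow> x \<otimes> (y \<oplus> z) = x \<otimes> y \<oplus> x \<otimes> z"
    and smult_mult_left: "\<lbrakk>x \<in> carrier A; y \<in> carrier A\<rbrakk> \<Longrightarrow> (c \<odot> x) \<otimes> y = c \<odot> (x \<otimes> y)"
    and smult_mult_right: "\<lbrakk>x \<in> carrier A; y \<in> carrier A\<rbrakk> \<Longrightarrow> x \<otimes> (c \<odot> y) = c \<odot> (x \<otimes> y)"
    and star_closed: "x \<in> carrier A \<Longrightarrow> star A x \<in> carrier A"
    and star_star: "x \<in> carrier A \<Longrightarrow> star A (star A x) = x"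
    and star_add: "\<lbrakk>x \<in> carrier A; y \<in> carrier A\<rbrakk> \<Longrightarrow> star A (x \<oplus> y) = star A x \<oplus> star A y"
    and star_smult: "x \<in> carrier A \<Longrightarrow> star A (c \<odot> x) = cnj c \<odot> star A x"
    and star_mult: "\<lbrakk>x \<in> carrier A; y \<in> carrier A\<rbrakk> \<Longrightarrow> star A (x \<otimes> y) = star A y \<otimes> star A x"
    and cnorm_nonneg: "x \<in> carrier A \<Longrightarrow> 0 \<le> cnorm A x"
    and cnorm_eq_0_iff: "x \<in> carrier A \<Longrightarrow> cnorm A x = 0 \<longleftrightarrow> x = \<zero>"
    and cnorm_smult: "x \<in> carrier A \<Longrightarrow> cnorm A (c \<odot> x) = cmod c * cnorm A x"
    and cnorm_triangle: "\<lbrakk>x \<in> carrier A; y \<in> carrier A\<rbrakk> \<Longrightarrow> cnorm A (x \<oplus> y) \<le> cnorm A x + cnorm A y"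
    and cnorm_mult: "\<lbrakk>x \<in> carrier A; y \<in> carrier A\<rbrakk> \<Longrightarrow> cnorm A (x \<otimes> y) \<le> cnorm A x * cnorm A y"
    and cstar_identity: "x \<in> carrier A \<Longrightarrow> cnorm A (star A x \<otimes> x) = (cnorm A x)\<^sup>2"
    and complete: "\<lbrakk>\<And>n. X n \<in> carrier A; cauchy_seq A X\<rbrakk> \<Longrightarrow> \<exists>l\<in>carrier A. seq_tendsto A X l"

definition is_projection :: "('a, 'm) cstar_scheme \<Rightarrow> 'a \<Rightarrow> bool" where
  "is_projection A p \<longleftrightarrow> p \<in> carrier A \<and> star A p = p \<and> p \<otimes>\<^bsub>A\<^esub> p = p"

definition is_partial_isometry :: "('a, 'm) cstar_scheme \<Rightarrow> 'a \<Rightarrow> bool" where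
  "is_partial_isometry A s \<longleftrightarrow> s \<in> carrier A \<and> s \<otimes>\<^bsub>A\<^esub> star A s \<otimes>\<^bsub>A\<^esub> s = s"

text \<open>The order of a C*-algebra: \<open>a \<le> b\<close> iff \<open>b - a\<close> is positive, i.e. of the form \<open>c\<^sup>* c\<close>.\<close>

definition cstar_le :: "('a, 'm) cstar_scheme \<Rightarrow> 'a \<Rightarrow> 'a \<Rightarrow> bool" where
  "cstar_le A a b \<longleftrightarrow> a \<in> carrier A \<and> b \<in> carrier A \<and>
     (\<exists>c\<in>carrier A. b \<ominus>\<^bsub>A\<^esub> a = star A c \<otimes>\<^bsub>A\<^esub> c)"

definition is_unit_element :: "('a, 'm) cstar_scheme \<Rightarrow> 'a \<Rightarrow> bool" where
  "is_unit_element A u \<longleftrightarrow> u \<in> carrier A \<and> (\<forall>x\<in>carrier A. u \<otimes>\<^bsub>A\<^esub> x = x \<and> x \<otimes>\<^bsub>A\<^esub> u = x)"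

definition closed_star_subalgebra :: "('a, 'm) cstar_scheme \<Rightarrow> 'a set \<Rightarrow> bool" where
  "closed_star_subalgebra A B \<longleftrightarrow>
     B \<subseteq> carrier A \<and> \<zero>\<^bsub>A\<^esub> \<in> B \<and>
     (\<forall>x\<in>B. \<forall>y\<in>B. x \<oplus>\<^bsub>A\<^esub> y \<in> B \<and> x \<otimes>\<^bsub>A\<^esub> y \<in> B) \<and>
     (\<forall>c. \<forall>x\<in>B. c \<odot>\<^bsub>A\<^esub> x \<in> B) \<and>
     (\<forall>x\<in>B. star A x \<in> B) \<and>
     (\<forall>x l. (\<forall>n. x n \<in> B) \<and> l \<in> carrier A \<and> seq_tendsto A x l \<longrightarrow> l \<in> B)"

definition generated_cstar :: "('a, 'm) cstar_scheme \<Rightarrow> 'a set \<Rightarrow> 'a set" where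
  "generated_cstar A X = \<Inter>{B. closed_star_subalgebra A B \<and> X \<subseteq> B}"

text \<open>Extensionality (\<open>\<rightarrow>\<^sub>E\<close>) makes a homomorphism determined by its values on the carrier.\<close>

definition star_hom :: "('a, 'm) cstar_scheme \<Rightarrow> ('b, 'n) cstar_scheme \<Rightarrow> ('a \<Rightarrow> 'b) set" where
  "star_hom A B = {\<phi> \<in> carrier A \<rightarrow>\<^sub>E carrier B.
     (\<forall>x\<in>carrier A. \<forall>y\<in>carrier A.
        \<phi> (x \<oplus>\<^bsub>A\<^esub> y) = \<phi> x \<oplus>\<^bsub>B\<^esub> \<phi> y \<and> \<phi> (x \<otimes>\<^bsub>A\<^esub> y) = \<phi> x \<otimes>\<^bsub>B\<^esub> \<phi> y) \<and>
     (\<forall>c. \<forall>x\<in>carrier A. \<phi> (c \<odot>\<^bsub>A\<^esub> x) = c \<odot>\<^bsub>B\<^esub> \<phi> x) \<and>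
     (\<forall>x\<in>carrier A. \<phi> (star A x) = star B (\<phi> x))}"


section \<open>Hypergraphs and their C*-algebras\<close>

record ('v, 'e) hypergraph =
  vertices :: "'v set"
  edges :: "'e set"
  range_of :: "'e \<Rightarrow> 'v set"
  source_of :: "'e \<Rightarrow> 'v set"

definition finite_hypergraph :: "('v, 'e) hypergraph \<Rightarrow> bool" where
  "finite_hypergraph G \<longleftrightarrow> finite (vertices G) \<and> finite (edges G) \<and>
     (\<forall>e\<in>edges G. range_of G e \<in> Pow (vertices G) - {{}} \<and>
                  source_of G e \<in> Pow (vertices G) - {{}})"

definition is_sink :: "('v, 'e) hypergraph \<Rightarrow> 'v \<Rightarrow> bool" where
  "is_sink G v \<longleftrightarrow> (\<forall>e\<in>edges G. v \<notin> source_of G e)"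

definition hypergraph_family ::
  "('v, 'e) hypergraph \<Rightarrow> ('a, 'm) cstar_scheme \<Rightarrow> ('v \<Rightarrow> 'a) \<Rightarrow> ('e \<Rightarrow> 'a) \<Rightarrow> bool" where
  "hypergraph_family G A p s \<longleftrightarrow>
     (\<forall>v\<in>vertices G. is_projection A (p v)) \<and>
     (\<forall>v\<in>vertices G. \<forall>w\<in>vertices G. v \<noteq> w \<longrightarrow> p v \<otimes>\<^bsub>A\<^esub> p w = \<zero>\<^bsub>A\<^esub>) \<and>
     (\<forall>e\<in>edges G. is_partial_isometry A (s e)) \<and>
     (\<forall>e\<in>edges G. \<forall>f\<in>edges G. star A (s e) \<otimes>\<^bsub>A\<^esub> s f =
        (if e = f then \<Oplus>\<^bsub>A\<^esub>v\<in>range_of G e. p v else \<zero>\<^bsub>A\<^esub>)) \<and>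
     (\<forall>e\<in>edges G. cstar_le A (s e \<otimes>\<^bsub>A\<^esub> star A (s e)) (\<Oplus>\<^bsub>A\<^esub>v\<in>source_of G e. p v)) \<and>
     (\<forall>v\<in>vertices G. \<not> is_sink G v \<longrightarrow>
        cstar_le A (p v) (\<Oplus>\<^bsub>A\<^esub>e\<in>{e \<in> edges G. v \<in> source_of G e}. s e \<otimes>\<^bsub>A\<^esub> star A (s e)))"

text \<open>\<open>A\<close> together with \<open>p\<close> and \<open>s\<close> is the hypergraph C*-algebra: it is generated by a family
  satisfying the relations, and every such family in a C*-algebra \<open>B\<close> is the image of this one
  under a unique *-homomorphism. HOL cannot quantify over the type carrying \<open>B\<close>, but
  \<open>real\<close> is large enough: inside any C*-algebra a finite family generates a separable C*-algebra,
  which has at most continuum many elements and hence an isomorphic copy carried by a set of reals.\<close>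

definition is_hypergraph_cstar_algebra ::
  "('v, 'e) hypergraph \<Rightarrow> 'a cstar \<Rightarrow> ('v \<Rightarrow> 'a) \<Rightarrow> ('e \<Rightarrow> 'a) \<Rightarrow> bool" where
  "is_hypergraph_cstar_algebra G A p s \<longleftrightarrow>
     cstar_algebra A \<and>
     hypergraph_family G A p s \<and>
     carrier A = generated_cstar A (p ` vertices G \<union> s ` edges G) \<and>
     (\<forall>(B :: real cstar) q t. cstar_algebra B \<and> hypergraph_family G B q t \<longrightarrow>
        (\<exists>!\<phi>. \<phi> \<in> star_hom A B \<and>
              (\<forall>v\<in>vertices G. \<phi> (p v) = q v) \<and> (\<forall>e\<in>edges G. \<phi> (s e) = t e)))"

end

(* Write x' for the adjoint of x. For a source projection q with s s' <= q, write q - s s' = c' c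
   and cut down by 1 - q: with d = (1 - q) s and f = c (1 - q) this gives f' f + d d' = 0, and
   d = 0 is wanted. No spectral theory is needed for that: j = d' f' satisfies j j' = -(d' d)^2 and
   j' j = -(f f')^2, so expanding the real and imaginary parts of j yields a vanishing sum of four
   squares of self-adjoint elements. Such a sum has only zero terms, because
   |t - h^2| <= sqrt (t^2 + |h|^4) = t + o(1) and |t + y^2| = t + |y|^2 as t grows; in the absence
   of a unit both estimates are applied to a vector. Hence s = q s, and s = s s' s gives the
   other side, so the sum of the p_v fixes the generators and therefore the whole algebra. *)

theory Submission
  imports Defs
begin

context cstar_algebra
begin

section \<open>Scalar arithmetic and normal forms of *-polynomials\<close>

lemma smult_scalar_add: "x \<in> carrier A \<Longrightarrow> (a + b) \<odot> x = a \<odot> x \<oplus> b \<odot> x"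
  using smult_l_distr[of a b x] by (simp add: complex_ring_def)

lemma smult_smult: "x \<in> carrier A \<Longrightarrow> a \<odot> (b \<odot> x) = (a * b) \<odot> x"
  using smult_assoc1[of a b x] by (simp add: complex_ring_def)

lemma smult_unit: "x \<in> carrier A \<Longrightarrow> 1 \<odot> x = x"
  using smult_one[of x] by (simp add: complex_ring_def)

lemma smult_in: "x \<in> carrier A \<Longrightarrow> c \<odot> x \<in> carrier A"
  using smult_closed[of c x] by (simp add: complex_ring_def)

lemma smult_add_right:
  "\<lbrakk>x \<in> carrier A; y \<in> carrier A\<rbrakk> \<Longrightarrow> c \<odot> (x \<oplus> y) = c \<odot> x \<oplus> c \<odot> y"
  using smult_r_distr[of c x y] by (simp add: complex_ring_def)

lemma smult_scalar_zero: "x \<in> carrier A \<Longrightarrow> 0 \<odot> x = \<zero>"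
  using smult_l_null[of x] by (simp add: complex_ring_def)

text \<open>Every negative is written as multiplication by the scalar -1, so that only sums of
  scalar multiples have to be normalised below.\<close>

lemma neg_eq_smult: "x \<in> carrier A \<Longrightarrow> \<ominus> x = (-1) \<odot> x"
proof -
  assume x: "x \<in> carrier A"
  have "x \<oplus> (-1) \<odot> x = \<zero>"
    using smult_scalar_add[OF x, of 1 "-1"] by (simp add: x smult_unit smult_scalar_zero)
  then show ?thesis
    using x by (metis M.minus_equality M.a_comm smult_in)
qed

lemma diff_eq_smult: "\<lbrakk>x \<in> carrier A; y \<in> carrier A\<rbrakk> \<Longrightarrow> x \<ominus> y = x \<oplus> (-1) \<odot> y"
  by (simp add: M.minus_eq neg_eq_smult)

text \<open>Collects like terms that ordering by associativity and commutativity has made adjacent;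
  a bare summand counts as one with coefficient 1.\<close>

lemma smult_add_collect1:
  assumes "x \<in> carrier A"
  shows "c \<odot> x \<oplus> d \<odot> x = (c + d) \<odot> x" "x \<oplus> d \<odot> x = (1 + d) \<odot> x" "d \<odot> x \<oplus> x = (d + 1) \<odot> x"
  using assms by (simp_all add: smult_scalar_add smult_unit)

lemma smult_add_collect2:
  assumes "x \<in> carrier A" "y \<in> carrier A"
  shows "c \<odot> x \<oplus> (d \<odot> x \<oplus> y) = (c + d) \<odot> x \<oplus> y" "x \<oplus> (d \<odot> x \<oplus> y) = (1 + d) \<odot> x \<oplus> y"
    "d \<odot> x \<oplus> (x \<oplus> y) = (d + 1) \<odot> x \<oplus> y"
  using assms by (simp_all add: smult_scalar_add smult_in smult_unit M.a_assoc)

lemmas smult_add_collect = smult_add_collect1 smult_add_collect2 smult_unit smult_scalar_zero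

text \<open>The term order may leave one or two other summands between \<open>x\<close> and
  \<open>(-1) \<odot> x\<close>, out of reach of the collecting rules.\<close>

lemma add_cancel:
  assumes "x \<in> carrier A" "y \<in> carrier A" "z \<in> carrier A"
  shows "x \<oplus> (y \<oplus> (-1) \<odot> x) = y" "x \<oplus> (y \<oplus> ((-1) \<odot> x \<oplus> z)) = y \<oplus> z"
    "x \<oplus> (y \<oplus> (z \<oplus> (-1) \<odot> x)) = y \<oplus> z"
proof -
  have "x \<oplus> (y \<oplus> (-1) \<odot> x) = y \<oplus> (x \<oplus> (-1) \<odot> x)"
    using assms by (simp add: smult_in M.a_ac)
  then show "x \<oplus> (y \<oplus> (-1) \<odot> x) = y"
    using assms by (simp add: smult_add_collect)
  have "x \<oplus> (y \<oplus> ((-1) \<odot> x \<oplus> z)) = y \<oplus> ((x \<oplus> (-1) \<odot> x) \<oplus> z)"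
    using assms by (simp add: smult_in M.a_ac)
  then show "x \<oplus> (y \<oplus> ((-1) \<odot> x \<oplus> z)) = y \<oplus> z"
    using assms by (simp add: smult_add_collect)
  then show "x \<oplus> (y \<oplus> (z \<oplus> (-1) \<odot> x)) = y \<oplus> z"
    using assms by (simp add: smult_in M.a_ac)
qed

lemmas closed = mult_closed star_closed smult_in

lemma mult_zero:
  assumes "x \<in> carrier A" shows "x \<otimes> \<zero> = \<zero>" "\<zero> \<otimes> x = \<zero>"
  using smult_mult_right[OF assms assms, of 0] smult_mult_left[OF assms assms, of 0] assms
  by (simp_all add: smult_scalar_zero closed)

lemmas expand = mult_add_left mult_add_right smult_mult_left smult_mult_right smult_add_right
  smult_smult mult_assoc star_add star_mult star_smult star_star

section \<open>Norm estimates replacing spectral theory\<close>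

text \<open>For c = i and c = -i the cross terms of (p + c q)' (p + c q) cancel, because p' q = q'
  p. By the C*-identity both p + i q and p - i q therefore have norm sqrt ?N, and p is their
  mean.\<close>

lemma norm_square_le_add_square:
  assumes p: "p \<in> carrier A" and q: "q \<in> carrier A"
    and comm: "star A p \<otimes> q = star A q \<otimes> p"
  shows "(cnorm A p)\<^sup>2 \<le> cnorm A (star A p \<otimes> p \<oplus> star A q \<otimes> q)"
proof -
  let ?N = "cnorm A (star A p \<otimes> p \<oplus> star A q \<otimes> q)"
  have rot: "(cnorm A (p \<oplus> c \<odot> q))\<^sup>2 = ?N" if c: "cnj c = - c" "c * c = -1" for c
  proof -
    have "star A (p \<oplus> c \<odot> q) \<otimes> (p \<oplus> c \<odot> q) = star A p \<otimes> p \<oplus> star A q \<otimes> q"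
      using p q c by (simp add: expand closed comm M.a_ac smult_add_collect)
    then show ?thesis using cstar_identity[of "p \<oplus> c \<odot> q"] p q by (simp add: closed)
  qed
  have root: "cnorm A (p \<oplus> c \<odot> q) = sqrt ?N" if c: "cnj c = - c" "c * c = -1" for c
    using rot[OF c] cnorm_nonneg[of "p \<oplus> c \<odot> q"] p q by (simp add: closed real_sqrt_unique)
  have "2 \<odot> p = (p \<oplus> \<i> \<odot> q) \<oplus> (p \<oplus> (- \<i>) \<odot> q)"
    using p q by (simp add: closed M.a_ac smult_add_collect)
      (metis smult_scalar_add smult_unit one_add_one)
  then have "2 * cnorm A p \<le> cnorm A (p \<oplus> \<i> \<odot> q) + cnorm A (p \<oplus> (- \<i>) \<odot> q)"
    using cnorm_triangle[of "p \<oplus> \<i> \<odot> q" "p \<oplus> (- \<i>) \<odot> q"] cnorm_smult[OF p, of 2] p q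
    by (simp add: closed)
  then have "cnorm A p \<le> sqrt ?N" by (simp add: root)
  then show ?thesis
    using cnorm_nonneg[OF p] p q
    by (metis cnorm_nonneg real_sqrt_pow2 power_mono closed(1,2) M.add.m_closed)
qed

text \<open>With a = h^2 this rests on (t - a)^2 + 2 t a = t^2 + a^2. The factor sqrt (2 t) in
  \<open>q\<close> makes q' q cancel the cross term of p' p, and the preceding estimate then
  discards \<open>q\<close>.\<close>

lemma norm_real_minus_square_le:
  fixes t :: real
  assumes h: "h \<in> carrier A" "star A h = h" and v: "v \<in> carrier A" and t: "t \<ge> 0"
  shows "cnorm A (complex_of_real t \<odot> v \<oplus> (-1) \<odot> (h \<otimes> (h \<otimes> v)))
    \<le> sqrt (t\<^sup>2 + (cnorm A h)^4) * cnorm A v"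
proof -
  define p where "p = complex_of_real t \<odot> v \<oplus> (-1) \<odot> (h \<otimes> (h \<otimes> v))"
  define r where "r = complex_of_real (sqrt (2 * t))"
  define q where "q = r \<odot> (h \<otimes> v)"
  have rr: "r * r = 2 * complex_of_real t" "cnj r = r"
    using t by (simp_all add: r_def of_real_mult[symmetric] del: of_real_mult) simp
  have pq: "p \<in> carrier A" "q \<in> carrier A" using h v by (simp_all add: p_def q_def closed)
  have comm: "star A p \<otimes> q = star A q \<otimes> p"
    using h v rr by (simp add: p_def q_def expand closed mult.commute)
  let ?w = "h \<otimes> (h \<otimes> v)"
  have "star A p \<otimes> p \<oplus> star A q \<otimes> q
     = complex_of_real (t\<^sup>2) \<odot> (star A v \<otimes> v) \<oplus> star A ?w \<otimes> ?w"
    using h v rr by (simp add: p_def q_def expand closed M.a_ac)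
      (simp add: h v closed M.a_ac smult_add_collect power2_eq_square)
  then have "cnorm A (star A p \<otimes> p \<oplus> star A q \<otimes> q)
     \<le> cnorm A (complex_of_real (t\<^sup>2) \<odot> (star A v \<otimes> v)) + cnorm A (star A ?w \<otimes> ?w)"
    using h v by (simp add: cnorm_triangle closed)
  also have "\<dots> = t\<^sup>2 * (cnorm A v)\<^sup>2 + (cnorm A ?w)\<^sup>2"
    using h v cstar_identity[of v] cstar_identity[of ?w]
    by (simp add: cnorm_smult closed norm_power del: of_real_power)
  also have "\<dots> \<le> t\<^sup>2 * (cnorm A v)\<^sup>2 + ((cnorm A h)\<^sup>2 * cnorm A v)\<^sup>2"
  proof -
    have "cnorm A ?w \<le> cnorm A h * (cnorm A h * cnorm A v)"
      using h v by (meson cnorm_mult cnorm_nonneg mult_closed mult_left_mono order_trans)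
    then have "(cnorm A ?w)\<^sup>2 \<le> ((cnorm A h)\<^sup>2 * cnorm A v)\<^sup>2"
      using cnorm_nonneg[of ?w] h v
      by (intro power_mono) (simp_all add: closed power2_eq_square mult.assoc)
    then show ?thesis by simp
  qed
  also have "\<dots> = (sqrt (t\<^sup>2 + (cnorm A h)^4) * cnorm A v)\<^sup>2"
    by (simp add: power_mult_distrib algebra_simps)
  finally have "(cnorm A p)\<^sup>2 \<le> (sqrt (t\<^sup>2 + (cnorm A h)^4) * cnorm A v)\<^sup>2"
    using norm_square_le_add_square[OF pq comm] by linarith
  then show ?thesis
    unfolding p_def[symmetric] by (rule power2_le_imp_le) (simp add: v cnorm_nonneg)
qed

text \<open>The vector on which t + y^2 attains its norm is y itself. The boundary case t = |y|^2
  comes from an identity between squares, larger t from convexity.\<close>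

lemma norm_real_plus_square_ge:
  fixes t :: real
  assumes y: "y \<in> carrier A" "star A y = y" and t: "t \<ge> (cnorm A y)\<^sup>2"
  shows "(t + (cnorm A y)\<^sup>2) * cnorm A y \<le> cnorm A (complex_of_real t \<odot> y \<oplus> y \<otimes> (y \<otimes> y))"
proof (cases "cnorm A y = 0")
  case True
  then show ?thesis using y by (simp add: cnorm_nonneg closed)
next
  case False
  define n where "n = cnorm A y"
  have n: "n > 0" using False cnorm_nonneg[OF y(1)] by (simp add: n_def)
  define r where "r = complex_of_real n"
  have r: "cnj r = r" by (simp add: r_def)
  define z where "z = y \<otimes> (y \<otimes> y)"
  have z: "z \<in> carrier A" using y by (simp add: z_def closed)
  \<comment> \<open>These are the terms of (n^2 + y^2)^2 = (n^2 - y^2)^2 + (2 n y)^2 multiplied by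
    y^2, so m' m = q' q + p' p. The norm of \<open>q\<close> is exactly 2 n^3, since |y^2| = n^2 for
    self-adjoint y.\<close>
  define p where "p = (r * r) \<odot> y \<oplus> (-1) \<odot> z"
  define q where "q = (2 * r) \<odot> (y \<otimes> y)"
  define m where "m = (r * r) \<odot> y \<oplus> z"
  have pq: "p \<in> carrier A" "q \<in> carrier A" and m: "m \<in> carrier A"
    using y z by (simp_all add: p_def q_def m_def closed)
  have "star A q \<otimes> q \<oplus> star A p \<otimes> p = star A m \<otimes> m"
    using y r by (simp add: p_def q_def m_def z_def expand closed M.a_ac)
      (simp add: y closed M.a_ac smult_add_collect)
  moreover have "star A q \<otimes> p = star A p \<otimes> q"
    using y r by (simp add: p_def q_def z_def expand closed algebra_simps)
  ultimately have "(cnorm A q)\<^sup>2 \<le> (cnorm A m)\<^sup>2"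
    using norm_square_le_add_square[of q p] pq m by (simp add: cstar_identity)
  then have "cnorm A q \<le> cnorm A m" by (rule power2_le_imp_le) (simp add: m cnorm_nonneg)
  moreover have "cnorm A (y \<otimes> y) = n\<^sup>2" using cstar_identity[of y] y by (simp add: n_def)
  then have "cnorm A q = 2 * n * n\<^sup>2"
    using y n by (simp add: q_def cnorm_smult closed norm_mult r_def)
  ultimately have low: "2 * n * n\<^sup>2 \<le> cnorm A m" by simp
  have zn: "cnorm A z \<le> n * n\<^sup>2"
    using cnorm_mult[of y "y \<otimes> y"] y \<open>cnorm A (y \<otimes> y) = n\<^sup>2\<close> by (simp add: z_def closed n_def)
  define w where "w = complex_of_real t \<odot> y \<oplus> z"
  have w: "w \<in> carrier A" using y z by (simp add: w_def closed)
  have t': "t \<ge> n\<^sup>2" "t > 0" using t n by (simp_all add: n_def) (smt (verit) n n_def zero_less_power)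
  txt \<open>\<open>m\<close> lies between \<open>z\<close> and \<open>w\<close>, so the lower bound for \<open>m\<close> extrapolates convexly to \<open>w\<close>.\<close>
  have "m = complex_of_real (1 - n\<^sup>2 / t) \<odot> z \<oplus> complex_of_real (n\<^sup>2 / t) \<odot> w"
    using y z t' by (simp add: m_def w_def expand closed r_def M.a_ac smult_add_collect power2_eq_square)
  then have "cnorm A m \<le> (1 - n\<^sup>2 / t) * cnorm A z + n\<^sup>2 / t * cnorm A w"
    using cnorm_triangle[of "complex_of_real (1 - n\<^sup>2 / t) \<odot> z" "complex_of_real (n\<^sup>2 / t) \<odot> w"]
      cnorm_smult[OF z, of "complex_of_real (1 - n\<^sup>2 / t)"]
      cnorm_smult[OF w, of "complex_of_real (n\<^sup>2 / t)"] z w t'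
    by (simp add: closed norm_divide norm_power del: of_real_diff of_real_divide of_real_power)
  also have "\<dots> \<le> (1 - n\<^sup>2 / t) * (n * n\<^sup>2) + n\<^sup>2 / t * cnorm A w"
    using zn t' by (simp add: mult_left_mono)
  finally have "2 * n * n\<^sup>2 \<le> (1 - n\<^sup>2 / t) * (n * n\<^sup>2) + n\<^sup>2 / t * cnorm A w"
    using low by linarith
  then have "(t + n\<^sup>2) * n * n\<^sup>2 \<le> cnorm A w * n\<^sup>2"
    using t' by (simp add: field_simps)
  then show ?thesis using n by (simp add: w_def z_def n_def)
qed

section \<open>Vanishing sums of squares and of positive elements\<close>

text \<open>Multiplied by y, the relation reads (3 t + y^2) y = (t - h1^2) y + (t - h2^2) y + (t -
  h3^2) y. For large t the left side has norm at least (3 t + |y|^2) |y|, the right side at most (3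
  t + o(1)) |y|.\<close>

lemma sum_squares_zero:
  assumes h: "h1 \<in> carrier A" "star A h1 = h1" "h2 \<in> carrier A" "star A h2 = h2"
    "h3 \<in> carrier A" "star A h3 = h3" and y: "y \<in> carrier A" "star A y = y"
    and sum0: "h1 \<otimes> h1 \<oplus> (h2 \<otimes> h2 \<oplus> (h3 \<otimes> h3 \<oplus> y \<otimes> y)) = \<zero>"
  shows "y = \<zero>"
proof (rule ccontr)
  assume "y \<noteq> \<zero>"
  then have n: "cnorm A y > 0" using y cnorm_nonneg[of y] cnorm_eq_0_iff[of y] by linarith
  define K where "K = (cnorm A h1)^4 + (cnorm A h2)^4 + (cnorm A h3)^4"
  define N where "N = (cnorm A y)\<^sup>2"
  have N: "N > 0" using n by (simp add: N_def)
  have K: "K \<ge> 0" by (simp add: K_def)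
  \<comment> \<open>The summand N ensures N <= 3 t, as the lower bound demands. The other gives K <=
    t N / 3, hence sqrt (t^2 + K) <= t + N / 6; three such errors add up to N / 2, which is less
    than N.\<close>
  define t where "t = N + 3 * K / N"
  have t: "t > 0" "N \<le> 3 * t" "3 * K \<le> t * N"
    using N K by (simp_all add: t_def field_simps add_pos_nonneg)
  have sqrt_le: "sqrt (t\<^sup>2 + k) \<le> t + N / 6" if "k \<le> K" for k
  proof (rule real_le_lsqrt)
    have "t\<^sup>2 + k \<le> t\<^sup>2 + t * N / 3" using that t by simp
    also have "\<dots> \<le> (t + N / 6)\<^sup>2" using N by (simp add: power2_eq_square field_simps)
    finally show "t\<^sup>2 + k \<le> (t + N / 6)\<^sup>2" .
  qed (use t N in simp)
  define u where "u h = complex_of_real t \<odot> y \<oplus> (-1) \<odot> (h \<otimes> (h \<otimes> y))" for h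
  have u: "cnorm A (u h) \<le> (t + N / 6) * cnorm A y" "u h \<in> carrier A"
    if "h \<in> carrier A" "star A h = h" "(cnorm A h)^4 \<le> K" for h
  proof -
    show "u h \<in> carrier A" using that y by (simp add: u_def closed)
    show "cnorm A (u h) \<le> (t + N / 6) * cnorm A y"
      using norm_real_minus_square_le[OF that(1,2) y(1), of t] sqrt_le[OF that(3)] t n
      unfolding u_def by (meson less_imp_le mult_right_mono order_trans)
  qed
  have "(h1 \<otimes> h1 \<oplus> (h2 \<otimes> h2 \<oplus> (h3 \<otimes> h3 \<oplus> y \<otimes> y))) \<otimes> y = \<zero>"
    using sum0 y smult_mult_left[of y y 0] by (simp add: smult_scalar_zero closed)
  then have s: "h1 \<otimes> (h1 \<otimes> y) \<oplus> (h2 \<otimes> (h2 \<otimes> y) \<oplus> (h3 \<otimes> (h3 \<otimes> y) \<oplus> y \<otimes> (y \<otimes> y))) = \<zero>"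
    using h y by (simp add: expand closed)
  \<comment> \<open>Solves the relation for b = y^3; substituting this into 3 t y + y^3 leaves
    exactly the three terms \<open>u h1\<close>, \<open>u h2\<close>, \<open>u h3\<close>.\<close>
  have cancel: "b = (-1) \<odot> a1 \<oplus> ((-1) \<odot> a2 \<oplus> (-1) \<odot> a3)"
    if "a1 \<in> carrier A" "a2 \<in> carrier A" "a3 \<in> carrier A" "b \<in> carrier A"
      "a1 \<oplus> (a2 \<oplus> (a3 \<oplus> b)) = \<zero>" for a1 a2 a3 b
  proof -
    have "b = ((-1) \<odot> a1 \<oplus> a1) \<oplus> (((-1) \<odot> a2 \<oplus> a2) \<oplus> (((-1) \<odot> a3 \<oplus> a3) \<oplus> b))"
      using that(1-4) by (simp add: smult_add_collect)
    also have "\<dots> = ((-1) \<odot> a1 \<oplus> ((-1) \<odot> a2 \<oplus> (-1) \<odot> a3)) \<oplus> (a1 \<oplus> (a2 \<oplus> (a3 \<oplus> b)))"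
      using that(1-4) by (simp add: closed M.a_ac)
    finally have "b = \<dots>" .
    then show ?thesis using that by (simp add: closed)
  qed
  have "complex_of_real (3 * t) \<odot> y \<oplus> y \<otimes> (y \<otimes> y) = u h1 \<oplus> (u h2 \<oplus> u h3)"
    using h y by (subst cancel[OF _ _ _ _ s])
      (simp_all add: u_def closed M.a_ac smult_add_collect)
  then have "cnorm A (complex_of_real (3 * t) \<odot> y \<oplus> y \<otimes> (y \<otimes> y))
      \<le> cnorm A (u h1) + (cnorm A (u h2) + cnorm A (u h3))"
    using cnorm_triangle[of "u h1" "u h2 \<oplus> u h3"] cnorm_triangle[of "u h2" "u h3"] h u(2)
    by (simp add: K_def)
  also have "\<dots> \<le> 3 * ((t + N / 6) * cnorm A y)"
    using u(1)[of h1] u(1)[of h2] u(1)[of h3] h by (simp add: K_def)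
  finally have "(3 * t + N) * cnorm A y \<le> (3 * t + N / 2) * cnorm A y"
    using norm_real_plus_square_ge[OF y, of "3 * t"] t by (simp add: N_def algebra_simps)
  then show False using n N by simp
qed

text \<open>Without square roots, f' f and d d' are not known to be squares of self-adjoint
  elements. Passing to j = d' f' replaces them by the squares of f f' and d' d, to which
  \<open>sum_squares_zero\<close> applies.\<close>

lemma add_positives_zero:
  assumes f: "f \<in> carrier A" and d: "d \<in> carrier A"
    and sum0: "star A f \<otimes> f \<oplus> d \<otimes> star A d = \<zero>"
  shows "d = \<zero>"
proof -
  define z where "z = f \<otimes> star A f"
  define w where "w = star A d \<otimes> d"
  define j where "j = star A d \<otimes> star A f"
  define k where "k = star A j"
  \<comment> \<open>The factor sqrt 2 absorbs the 2 in a^2 + b^2 = 2 (j k + k j) = -2 w^2 - 2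
    z^2.\<close>
  define r where "r = complex_of_real (sqrt 2)"
  have r: "r * r = 2" "cnj r = r"
    by (simp_all add: r_def of_real_mult[symmetric] del: of_real_mult)
  have zw: "z \<in> carrier A" "star A z = z" "w \<in> carrier A" "star A w = w"
    using f d by (simp_all add: z_def w_def closed expand)
  have jk: "j \<in> carrier A" "k \<in> carrier A" "star A j = k" "star A k = j"
    using f d by (simp_all add: j_def k_def closed expand)
  have neg: "star A f \<otimes> f = (-1) \<odot> (d \<otimes> star A d)"
  proof -
    have "star A f \<otimes> f
        = (star A f \<otimes> f \<oplus> d \<otimes> star A d) \<oplus> (-1) \<odot> (d \<otimes> star A d)"
      using f d by (simp add: closed M.a_assoc smult_add_collect)
    then show ?thesis using sum0 f d by (simp add: closed)
  qed
  have "j \<otimes> k = star A d \<otimes> ((star A f \<otimes> f) \<otimes> d)"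
    using f d by (simp add: j_def k_def closed expand)
  also have "\<dots> = (-1) \<odot> (w \<otimes> w)"
    unfolding neg using d by (simp add: w_def closed expand)
  finally have jjk: "j \<otimes> k = (-1) \<odot> (w \<otimes> w)" .
  have "z \<otimes> z = f \<otimes> ((star A f \<otimes> f) \<otimes> star A f)"
    using f by (simp add: z_def closed expand)
  also have "\<dots> = (-1) \<odot> (k \<otimes> j)"
    unfolding neg using f d by (simp add: j_def k_def closed expand)
  finally have zz: "z \<otimes> z = (-1) \<odot> (k \<otimes> j)" .
  \<comment> \<open>Up to sign, \<open>a\<close> and \<open>b\<close> are twice the real and
    imaginary parts of \<open>j\<close>; in a^2 + b^2 the terms in j^2 and k^2 cancel.\<close>
  define a where "a = j \<oplus> k"
  define b where "b = \<i> \<odot> j \<oplus> (- \<i>) \<odot> k"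
  have ab: "a \<in> carrier A" "star A a = a" "b \<in> carrier A" "star A b = b"
    using jk by (simp_all add: a_def b_def closed expand M.a_comm)
  have aa: "a \<otimes> a = j \<otimes> j \<oplus> (k \<otimes> k \<oplus> (j \<otimes> k \<oplus> k \<otimes> j))"
    using jk by (simp add: a_def closed expand M.a_ac)
  have bb: "b \<otimes> b = (-1) \<odot> (j \<otimes> j) \<oplus> ((-1) \<odot> (k \<otimes> k) \<oplus> (j \<otimes> k \<oplus> k \<otimes> j))"
    using jk by (simp add: b_def closed expand M.a_ac smult_unit)
  have double: "(x \<oplus> (y \<oplus> v)) \<oplus> ((-1) \<odot> x \<oplus> ((-1) \<odot> y \<oplus> v)) = 2 \<odot> v"
    if "x \<in> carrier A" "y \<in> carrier A" "v \<in> carrier A" for x y v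
  proof -
    have "(x \<oplus> (y \<oplus> v)) \<oplus> ((-1) \<odot> x \<oplus> ((-1) \<odot> y \<oplus> v))
        = (x \<oplus> (-1) \<odot> x) \<oplus> ((y \<oplus> (-1) \<odot> y) \<oplus> (v \<oplus> v))"
      using that by (simp add: closed M.a_ac)
    also have "\<dots> = 2 \<odot> v"
      using that smult_scalar_add[of v 1 1] by (simp add: smult_add_collect)
    finally show ?thesis .
  qed
  have aabb: "a \<otimes> a \<oplus> b \<otimes> b = 2 \<odot> (j \<otimes> k \<oplus> k \<otimes> j)"
    unfolding aa bb using jk by (intro double) (simp_all add: closed)
  have "a \<otimes> a \<oplus> (b \<otimes> b \<oplus> ((r \<odot> z) \<otimes> (r \<odot> z) \<oplus> (r \<odot> w) \<otimes> (r \<odot> w)))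
      = (a \<otimes> a \<oplus> b \<otimes> b) \<oplus> ((r \<odot> z) \<otimes> (r \<odot> z) \<oplus> (r \<odot> w) \<otimes> (r \<odot> w))"
    using ab zw by (simp add: closed M.a_assoc)
  also have "\<dots> = \<zero>"
    unfolding aabb using jk zw r
    by (simp add: closed smult_mult_left smult_mult_right smult_smult smult_add_right zz jjk
      M.a_assoc smult_add_collect)
  finally have "a \<otimes> a \<oplus> (b \<otimes> b \<oplus> ((r \<odot> z) \<otimes> (r \<odot> z) \<oplus> (r \<odot> w) \<otimes> (r \<odot> w))) = \<zero>" .
  \<comment> \<open>The term in \<open>w\<close> is placed last because w = d' d, so that the
    C*-identity leads from w = 0 to d = 0.\<close>
  then have "r \<odot> w = \<zero>"
    using ab zw r by (intro sum_squares_zero[of a b "r \<odot> z" "r \<odot> w"])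
      (simp_all add: closed star_smult)
  then have "cmod r * cnorm A w = 0"
    using cnorm_smult[OF zw(3), of r] cnorm_eq_0_iff[of \<zero>] by simp
  then have "(cnorm A d)\<^sup>2 = 0" using cstar_identity[OF d] r(1) by (auto simp: w_def)
  then show ?thesis using cnorm_eq_0_iff[OF d] by simp
qed

section \<open>Elements whose range projection lies below a projection\<close>

lemma projection_mult_of_le:
  assumes q: "is_projection A q" and s: "s \<in> carrier A"
    and le: "cstar_le A (s \<otimes> star A s) q"
  shows "q \<otimes> s = s"
proof -
  have q': "q \<in> carrier A" "star A q = q" "q \<otimes> q = q"
    using q by (simp_all add: is_projection_def)
  have qq: "q \<otimes> (q \<otimes> x) = q \<otimes> x" if "x \<in> carrier A" for x
    using that q' by (metis mult_assoc)
  obtain c where c: "c \<in> carrier A" and cc: "star A c \<otimes> c = q \<oplus> (-1) \<odot> (s \<otimes> star A s)"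
    using le s by (auto simp: cstar_le_def diff_eq_smult closed)
  define f where "f = c \<oplus> (-1) \<odot> (c \<otimes> q)"
  define d where "d = s \<oplus> (-1) \<odot> (q \<otimes> s)"
  have fd: "f \<in> carrier A" "d \<in> carrier A" using c s q' by (simp_all add: f_def d_def closed)
  \<comment> \<open>Formally \<open>g\<close> is (1 - q) c' c with c' c = q - s s'. As (1 - q) q =
    0, only -d s' remains, and multiplying by 1 - q on the right gives f' f = -d d'.\<close>
  define g where "g = (star A c \<otimes> c) \<oplus> (-1) \<odot> (q \<otimes> (star A c \<otimes> c))"
  have "g = (-1) \<odot> (d \<otimes> star A s)"
    unfolding g_def cc d_def using s q'
    by (simp add: closed expand qq M.a_ac add_cancel smult_add_collect)
  moreover have "star A f \<otimes> f = g \<oplus> (-1) \<odot> (g \<otimes> q)"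
    using c q' by (simp add: f_def g_def closed expand M.a_ac smult_unit)
  moreover have "star A d = star A s \<oplus> (-1) \<odot> (star A s \<otimes> q)"
    using s q' by (simp add: d_def closed expand)
  ultimately have "star A f \<otimes> f = (-1) \<odot> (d \<otimes> star A d)"
    using s q' fd by (simp add: closed expand smult_unit)
  then have "star A f \<otimes> f \<oplus> d \<otimes> star A d = \<zero>"
    using fd by (simp add: closed smult_add_collect)
  then have "d = \<zero>" by (rule add_positives_zero[OF fd])
  moreover have "s = d \<oplus> q \<otimes> s"
    using s q' by (simp add: d_def closed M.a_ac smult_add_collect)
  ultimately show ?thesis using s q' by (simp add: closed)
qed

section \<open>Limits and the closed subalgebra on which an element acts as a unit\<close>

text \<open>Since m - l = (x n - l) - (x n - m), its norm is at most (K + 1) |x n - l|, which tends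
  to 0. The intended m is u l or l u with K = |u|, so the bound stands in for continuity of
  multiplication.\<close>

lemma tendsto_eqI:
  assumes x: "\<And>n. x n \<in> carrier A" and l: "l \<in> carrier A" "seq_tendsto A x l"
    and m: "m \<in> carrier A" and K: "\<And>n. cnorm A (x n \<ominus> m) \<le> K * cnorm A (x n \<ominus> l)"
  shows "m = l"
proof -
  have "cnorm A (m \<ominus> l) \<le> (K + 1) * cnorm A (x n \<ominus> l)" for n
  proof -
    have "m \<ominus> l = (-1) \<odot> (x n \<ominus> m) \<oplus> (x n \<ominus> l)"
      using x[of n] l m by (simp add: diff_eq_smult closed expand M.a_ac)
        (simp add: closed M.a_ac add_cancel smult_unit)
    then have "cnorm A (m \<ominus> l) \<le> cnorm A (x n \<ominus> m) + cnorm A (x n \<ominus> l)"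
      using cnorm_triangle[of "(-1) \<odot> (x n \<ominus> m)" "x n \<ominus> l"] x[of n] l m
      by (simp add: cnorm_smult closed)
    then show ?thesis using K[of n] by (simp add: algebra_simps)
  qed
  moreover have "(\<lambda>n. (K + 1) * cnorm A (x n \<ominus> l)) \<longlonglongrightarrow> (K + 1) * 0"
    using l(2) unfolding seq_tendsto_def by (intro tendsto_mult tendsto_const)
  ultimately have "cnorm A (m \<ominus> l) \<le> 0"
    by (intro LIMSEQ_le_const[where X = "\<lambda>n. (K + 1) * cnorm A (x n \<ominus> l)"]) auto
  then have "m \<ominus> l = \<zero>" using l m cnorm_nonneg[of "m \<ominus> l"] cnorm_eq_0_iff[of "m \<ominus> l"] by simp
  moreover have "m = (m \<ominus> l) \<oplus> l"
    using l m by (simp add: M.minus_eq M.a_assoc M.l_neg)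
  ultimately show ?thesis using l m by simp
qed

text \<open>Both equations are required together because the involution exchanges them when u is
  self-adjoint. A generated C*-algebra is contained in this set as soon as its generators
  are.\<close>

lemma closed_star_subalgebra_fixed:
  assumes u: "u \<in> carrier A" "star A u = u"
  shows "closed_star_subalgebra A {x \<in> carrier A. u \<otimes> x = x \<and> x \<otimes> u = x}"
    (is "closed_star_subalgebra A ?B")
  unfolding closed_star_subalgebra_def
proof (intro conjI ballI allI impI)
  show "\<zero> \<in> ?B" using u by (simp add: mult_zero)
  \<comment> \<open>For products, (x y) u is regrouped to the right but u (x y) to the left, so that
    u meets a factor that it fixes.\<close>
  show "x \<oplus> y \<in> ?B" "x \<otimes> y \<in> ?B" if "x \<in> ?B" "y \<in> ?B" for x y
    using that u by (auto simp: closed mult_add_left mult_add_right)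
      (simp_all add: mult_assoc flip: mult_assoc[of u])
  show "c \<odot> x \<in> ?B" if "x \<in> ?B" for c x
    using that u by (simp add: closed smult_mult_left smult_mult_right)
  show "star A x \<in> ?B" if "x \<in> ?B" for x
    using that u by simp (metis star_mult star_closed)
  show "l \<in> ?B" if xl: "(\<forall>n. x n \<in> ?B) \<and> l \<in> carrier A \<and> seq_tendsto A x l" for x l
  proof -
    have x: "x n \<in> carrier A" "u \<otimes> x n = x n" "x n \<otimes> u = x n" for n using xl by auto
    have "cnorm A (x n \<ominus> u \<otimes> l) \<le> cnorm A u * cnorm A (x n \<ominus> l)" for n
    proof -
      have "x n \<ominus> u \<otimes> l = u \<otimes> (x n \<ominus> l)"
        using x[of n] xl u by (simp add: diff_eq_smult closed expand)
      then show ?thesis using x[of n] xl u by (simp add: cnorm_mult)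
    qed
    then have "u \<otimes> l = l" using xl u x(1) by (intro tendsto_eqI[of x l]) (auto simp: closed)
    moreover have "cnorm A (x n \<ominus> l \<otimes> u) \<le> cnorm A u * cnorm A (x n \<ominus> l)" for n
    proof -
      have "x n \<ominus> l \<otimes> u = (x n \<ominus> l) \<otimes> u"
        using x[of n] xl u by (simp add: diff_eq_smult closed expand)
      then show ?thesis using x[of n] xl u cnorm_mult[of "x n \<ominus> l" u] by (simp add: mult.commute)
    qed
    then have "l \<otimes> u = l" using xl u x(1) by (intro tendsto_eqI[of x l]) (auto simp: closed)
    ultimately show ?thesis using xl by simp
  qed
qed auto

section \<open>Finite sums of orthogonal projections\<close>

lemma star_zero: "star A \<zero> = \<zero>"
  using star_smult[of \<zero> 0] by (simp add: smult_scalar_zero closed)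

lemma star_finsum:
  assumes "finite S" "\<And>v. v \<in> S \<Longrightarrow> p v \<in> carrier A"
  shows "star A (\<Oplus>v\<in>S. p v) = (\<Oplus>v\<in>S. star A (p v))"
  using assms
  by (induction S rule: finite_induct) (auto simp: star_zero star_add closed Pi_def)

lemma mult_finsum:
  assumes "finite S" "\<And>v. v \<in> S \<Longrightarrow> p v \<in> carrier A" "x \<in> carrier A"
  shows "x \<otimes> (\<Oplus>v\<in>S. p v) = (\<Oplus>v\<in>S. x \<otimes> p v)"
  using assms
  by (induction S rule: finite_induct) (auto simp: mult_zero mult_add_right closed Pi_def)

lemma finsum_mult:
  assumes "finite S" "\<And>v. v \<in> S \<Longrightarrow> p v \<in> carrier A" "x \<in> carrier A"
  shows "(\<Oplus>v\<in>S. p v) \<otimes> x = (\<Oplus>v\<in>S. p v \<otimes> x)"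
  using assms
  by (induction S rule: finite_induct) (auto simp: mult_zero mult_add_left closed Pi_def)

text \<open>Multiplying p v by the sum over V leaves only the diagonal term; summing over S gives
  the right-hand absorption, and adjoints give the left-hand one. The case S = V says that the whole
  sum is a projection.\<close>

lemma orthogonal_projections_finsum:
  assumes V: "finite V" and proj: "\<And>v. v \<in> V \<Longrightarrow> is_projection A (p v)"
    and orth: "\<And>v w. \<lbrakk>v \<in> V; w \<in> V; v \<noteq> w\<rbrakk> \<Longrightarrow> p v \<otimes> p w = \<zero>"
    and S: "S \<subseteq> V"
  shows "finsum A p S \<in> carrier A" "star A (finsum A p S) = finsum A p S"
    "finsum A p S \<otimes> finsum A p V = finsum A p S" "finsum A p V \<otimes> finsum A p S = finsum A p S"
proof -
  have p: "p v \<in> carrier A" "star A (p v) = p v" "p v \<otimes> p v = p v" if "v \<in> V" for v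
    using proj[OF that] by (auto simp: is_projection_def)
  have fin: "finite T" if "T \<subseteq> V" for T using V that finite_subset by blast
  have car: "finsum A p T \<in> carrier A" if "T \<subseteq> V" for T
    using that p by (intro M.finsum_closed) auto
  have st: "star A (finsum A p T) = finsum A p T" if "T \<subseteq> V" for T
    using that p star_finsum[OF fin[OF that], of p]
    by (auto intro!: M.finsum_cong' simp: subset_iff)
  have vV: "p v \<otimes> finsum A p V = p v" if v: "v \<in> V" for v
  proof -
    have "p v \<otimes> finsum A p V = (\<Oplus>w\<in>V. p v \<otimes> p w)" using V v p by (simp add: mult_finsum)
    also have "\<dots> = (\<Oplus>w\<in>V. if v = w then p w else \<zero>)"
      using v p orth by (intro M.finsum_cong') (auto simp: closed)
    also have "\<dots> = p v" using V v p by (intro M.finsum_singleton) auto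
    finally show ?thesis .
  qed
  have right: "finsum A p S \<otimes> finsum A p V = finsum A p S"
  proof -
    have "finsum A p S \<otimes> finsum A p V = (\<Oplus>v\<in>S. p v \<otimes> finsum A p V)"
      using fin[OF S] S p car[of V] by (intro finsum_mult) auto
    also have "\<dots> = finsum A p S" using S p vV by (intro M.finsum_cong') auto
    finally show ?thesis .
  qed
  show "finsum A p S \<in> carrier A" "star A (finsum A p S) = finsum A p S" by (simp_all add: car st S)
  show "finsum A p S \<otimes> finsum A p V = finsum A p S" by (rule right)
  show "finsum A p V \<otimes> finsum A p S = finsum A p S"
    using right star_mult[of "finsum A p S" "finsum A p V"] car[of V] car[of S] st[of V] st[of S] S
    by simp
qed

end

section \<open>The sum of the vertex projections as unit\<close>

theorem proposition3p5:
  fixes G :: "('v, 'e) hypergraph"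
    and A :: "'a cstar"
    and p :: "'v \<Rightarrow> 'a"
    and s :: "'e \<Rightarrow> 'a"
  assumes "finite_hypergraph G"
    and "is_hypergraph_cstar_algebra G A p s"
  shows "is_unit_element A (\<Oplus>\<^bsub>A\<^esub>v\<in>vertices G. p v)"
proof -
  interpret cstar_algebra A
    using assms(2) by (simp add: is_hypergraph_cstar_algebra_def)
  let ?V = "vertices G"
  define P where "P = (\<Oplus>\<^bsub>A\<^esub>v\<in>?V. p v)"
  have fam: "hypergraph_family G A p s"
    and gen: "carrier A = generated_cstar A (p ` ?V \<union> s ` edges G)"
    using assms(2) by (simp_all add: is_hypergraph_cstar_algebra_def)
  have V: "finite ?V"
    and sub: "\<And>e. e \<in> edges G \<Longrightarrow> range_of G e \<subseteq> ?V \<and> source_of G e \<subseteq> ?V"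
    using assms(1) by (auto simp: finite_hypergraph_def)
  have proj: "\<And>v. v \<in> ?V \<Longrightarrow> is_projection A (p v)"
    and orth: "\<And>v w. \<lbrakk>v \<in> ?V; w \<in> ?V; v \<noteq> w\<rbrakk> \<Longrightarrow> p v \<otimes>\<^bsub>A\<^esub> p w = \<zero>\<^bsub>A\<^esub>"
    using fam by (auto simp: hypergraph_family_def)
  have sums: "finsum A p S \<in> carrier A" "star A (finsum A p S) = finsum A p S"
    "finsum A p S \<otimes>\<^bsub>A\<^esub> P = finsum A p S" "P \<otimes>\<^bsub>A\<^esub> finsum A p S = finsum A p S"
    if "S \<subseteq> ?V" for S
    using orthogonal_projections_finsum[of ?V p S] V proj orth that by (simp_all add: P_def)
  have P: "P \<in> carrier A" "star A P = P"
    using sums[OF order_refl] by (simp_all add: P_def)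
  \<comment> \<open>On this closed *-subalgebra \<open>P\<close> is a two-sided unit, so it suffices
    to place the generators in it.\<close>
  let ?B = "{x \<in> carrier A. P \<otimes>\<^bsub>A\<^esub> x = x \<and> x \<otimes>\<^bsub>A\<^esub> P = x}"
  have "p v \<in> ?B" if v: "v \<in> ?V" for v
    using sums(3,4)[of "{v}"] v proj[OF v] by (simp add: is_projection_def Pi_def)
  moreover have "s e \<in> ?B" if e: "e \<in> edges G" for e
  proof -
    let ?Q = "finsum A p (source_of G e)" and ?R = "finsum A p (range_of G e)"
    have s: "s e \<in> carrier A" "s e \<otimes>\<^bsub>A\<^esub> star A (s e) \<otimes>\<^bsub>A\<^esub> s e = s e"
      and HR1: "star A (s e) \<otimes>\<^bsub>A\<^esub> s e = ?R"
      and HR2a: "cstar_le A (s e \<otimes>\<^bsub>A\<^esub> star A (s e)) ?Q"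
      using fam e by (simp_all add: hypergraph_family_def is_partial_isometry_def)
    \<comment> \<open>Idempotence of \<open>?Q\<close> is the absorption law with the source set in
      both roles, as the subset and as the whole set.\<close>
    have "finite (source_of G e)" using sub[OF e] V finite_subset by blast
    then have "?Q \<otimes>\<^bsub>A\<^esub> ?Q = ?Q"
      using orthogonal_projections_finsum(3)[of "source_of G e" p "source_of G e"] sub[OF e] proj orth
      by (meson subset_iff order_refl)
    then have Q: "?Q \<in> carrier A" "star A ?Q = ?Q" "?Q \<otimes>\<^bsub>A\<^esub> ?Q = ?Q" "P \<otimes>\<^bsub>A\<^esub> ?Q = ?Q"
      using sums[of "source_of G e"] sub[OF e] by simp_all
    \<comment> \<open>Left side: (HR2a) gives Q s = s, whence P s = P Q s = Q s = s.\<close>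
    have "?Q \<otimes>\<^bsub>A\<^esub> s e = s e"
      using Q s HR2a by (intro projection_mult_of_le) (auto simp: is_projection_def)
    then have left: "P \<otimes>\<^bsub>A\<^esub> s e = s e" using Q s P by (metis mult_assoc)
    have R: "?R \<in> carrier A" "?R \<otimes>\<^bsub>A\<^esub> P = ?R"
      using sums[of "range_of G e"] sub[OF e] by simp_all
    \<comment> \<open>Right side: (HR1) turns s = s s' s into s = s R, and R P = R gives s P =
      s.\<close>
    have "s e = s e \<otimes>\<^bsub>A\<^esub> ?R"
      using s HR1 mult_assoc[of "s e" "star A (s e)" "s e"] by (simp add: closed)
    then have "s e \<otimes>\<^bsub>A\<^esub> P = s e" using R s P by (metis mult_assoc)
    with left s show ?thesis by simp
  qed
  ultimately have "generated_cstar A (p ` ?V \<union> s ` edges G) \<subseteq> ?B"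
    using closed_star_subalgebra_fixed[OF P] by (auto simp: generated_cstar_def)
  then show ?thesis
    using gen P by (auto simp: is_unit_element_def P_def[symmetric])
qed

end
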